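(* Let $\mathcal P$ be a pure $2$-dimensional simplicial poset, let $G\subseteq\mathcal P^{(1)}$ be a bypassing subgraph in $\mathcal P$, and suppose $d_G=d'+d''$ for some metrics $d',d''$ on $\mathcal P$. Let $e$ be any edge of $\mathcal P$ with $B_G(e)\ne\emptyset$. Then for every walk $p=e_1\cdots e_n\in B_G(e)$ one has $d'(e_1)+\dots+d'(e_n)=d'(e)$.
   Context: A simplicial poset is a poset with unique minimum $\hat0$ in which every interval $[\hat0,x]$ is isomorphic to a Boolean lattice; elements whose lower interval is the Boolean lattice on $1,2,3$ elements are vertices, edges, triangles ($\mathcal P(0),\mathcal P(1),\mathcal P(2)$); each edge has two distinct endpoints, each triangle three distinct vertices and three edge facets. Pure $2$-dimensional: every maximal element is a triangle. $\mathcal P^{(1)}$ is the graph with vertices $\mathcal P(0)$ and edges $\mathcal P(1)$ (multiple edges allowed). A metric on $\mathcal P$ is a function $d:\mathcal P(1)\to\mathbb R_{\ge0}$ such that for every triangle with facets $e_1,e_2,e_3$: $d(e_1)+d(e_2)\ge d(e_3)$, $d(e_2)+d(e_3)\ge d(e_1)$, $d(e_1)+d(e_3)\ge d(e_2)$. A walk is a sequence of edges $e_1,\dots,e_n$ ($n\ge1$) with vertices $v_1,\dots,v_{n+1}$ such that $e_i$ has endpoints $v_i,v_{i+1}$; its length is $n$. If $e_i,e_{i+1}$ are consecutive edges of a walk and some triangle has facets $e_i,e_{i+1},\tilde e$, replacing $e_i,e_{i+1}$ by $\tilde e$ is an elementary contraction; a walk can be contracted to $q$ if $q$ results from a finite (possibly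 empty) sequence of elementary contractions. $G\subseteq\mathcal P^{(1)}$ is bypassing in $\mathcal P$ if it contains all vertices and every edge $e$ of $\mathcal P$ admits a walk in $G$ that can be contracted to the one-edge walk $e$. $B_G(e)$ is the set of shortest walks in $G$ that can be contracted to $e$, and for bypassing $G$, $d_G(e)$ is the common length of the walks in $B_G(e)$ (the graph metric induced by $G$). *)

theory Defs
  imports Complex_Main "HOL-Algebra.Order"
begin

section \<open>Simplicial posets\<close>

text \<open>\<open>lower_interval_boolean P x k\<close>: the interval from the minimum to \<open>x\<close> is order-isomorphic to
  the lattice of subsets of a \<open>k\<close>-element set.\<close>

definition lower_interval_boolean :: "('a, 'b) gorder_scheme \<Rightarrow> 'a \<Rightarrow> nat \<Rightarrow> bool" where
  "lower_interval_boolean P x k \<longleftrightarrow>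
     (\<exists>f. bij_betw f \<lbrace>\<bottom>\<^bsub>P\<^esub>..x\<rbrace>\<^bsub>P\<^esub> (Pow {..<k}) \<and>
          (\<forall>y\<in>\<lbrace>\<bottom>\<^bsub>P\<^esub>..x\<rbrace>\<^bsub>P\<^esub>. \<forall>z\<in>\<lbrace>\<bottom>\<^bsub>P\<^esub>..x\<rbrace>\<^bsub>P\<^esub>. y \<sqsubseteq>\<^bsub>P\<^esub> z \<longleftrightarrow> f y \<subseteq> f z))"

locale simplicial_poset = partial_order P + weak_partial_order_bottom P for P (structure) +
  assumes lower_interval_boolean: "x \<in> carrier P \<Longrightarrow> \<exists>k. lower_interval_boolean P x k"

definition cells :: "('a, 'b) gorder_scheme \<Rightarrow> nat \<Rightarrow> 'a set" where
  "cells P i = {x \<in> carrier P. lower_interval_boolean P x (i + 1)}"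

definition pure_two_dimensional :: "('a, 'b) gorder_scheme \<Rightarrow> bool" where
  "pure_two_dimensional P \<longleftrightarrow>
     (\<forall>x\<in>carrier P. (\<forall>y\<in>carrier P. x \<sqsubseteq>\<^bsub>P\<^esub> y \<longrightarrow> y = x) \<longrightarrow> x \<in> cells P 2)"

definition endpoints :: "('a, 'b) gorder_scheme \<Rightarrow> 'a \<Rightarrow> 'a set" where
  "endpoints P e = {v \<in> cells P 0. v \<sqsubseteq>\<^bsub>P\<^esub> e}"

text \<open>In a simplicial poset a triangle has exactly three edges below it, so \<open>a\<close>, \<open>b\<close>, \<open>c\<close> are
  automatically distinct.\<close>

definition triangle_with_facets ::
    "('a, 'b) gorder_scheme \<Rightarrow> 'a \<Rightarrow> 'a \<Rightarrow> 'a \<Rightarrow> 'a \<Rightarrow> bool" where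
  "triangle_with_facets P t a b c \<longleftrightarrow>
     t \<in> cells P 2 \<and> {x \<in> cells P 1. x \<sqsubseteq>\<^bsub>P\<^esub> t} = {a, b, c}"

text \<open>Only the values on edges matter.\<close>

definition metric_on_poset :: "('a, 'b) gorder_scheme \<Rightarrow> ('a \<Rightarrow> real) \<Rightarrow> bool" where
  "metric_on_poset P d \<longleftrightarrow>
     (\<forall>e\<in>cells P 1. 0 \<le> d e) \<and>
     (\<forall>t a b c. triangle_with_facets P t a b c \<longrightarrow>
        d a + d b \<ge> d c \<and> d b + d c \<ge> d a \<and> d a + d c \<ge> d b)"

section \<open>Subgraphs of the 1-skeleton and walks\<close>

text \<open>Incidence is inherited from the poset, so a graph is given by its vertices and edges alone.\<close>

record 'a skel_graph =
  gverts :: "'a set"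
  gedges :: "'a set"

definition one_skeleton :: "('a, 'b) gorder_scheme \<Rightarrow> 'a skel_graph" where
  "one_skeleton P = \<lparr>gverts = cells P 0, gedges = cells P 1\<rparr>"

definition subgraph_of_skeleton :: "('a, 'b) gorder_scheme \<Rightarrow> 'a skel_graph \<Rightarrow> bool" where
  "subgraph_of_skeleton P G \<longleftrightarrow>
     gverts G \<subseteq> gverts (one_skeleton P) \<and> gedges G \<subseteq> gedges (one_skeleton P) \<and>
     (\<forall>e\<in>gedges G. endpoints P e \<subseteq> gverts G)"

definition walk_in :: "('a, 'b) gorder_scheme \<Rightarrow> 'a skel_graph \<Rightarrow> 'a list \<Rightarrow> bool" where
  "walk_in P G es \<longleftrightarrow>
     es \<noteq> [] \<and> set es \<subseteq> gedges G \<and>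
     (\<exists>vs. length vs = length es + 1 \<and> set vs \<subseteq> gverts G \<and>
           (\<forall>i<length es. endpoints P (es ! i) = {vs ! i, vs ! (i + 1)}))"

text \<open>Two distinct edges of a triangle share exactly one vertex, so the result \<open>q\<close> of contracting
  a walk \<open>p\<close> is again a walk, and the vertex sequence need not be recorded.\<close>

definition elementary_contraction ::
    "('a, 'b) gorder_scheme \<Rightarrow> 'a list \<Rightarrow> 'a list \<Rightarrow> bool" where
  "elementary_contraction P p q \<longleftrightarrow>
     walk_in P (one_skeleton P) p \<and>
     (\<exists>xs ys a b c t. triangle_with_facets P t a b c \<and> p = xs @ [a, b] @ ys \<and> q = xs @ [c] @ ys)"

definition contracts_to :: "('a, 'b) gorder_scheme \<Rightarrow> 'a list \<Rightarrow> 'a list \<Rightarrow> bool" where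
  "contracts_to P = (elementary_contraction P)\<^sup>*\<^sup>*"

definition bypassing :: "('a, 'b) gorder_scheme \<Rightarrow> 'a skel_graph \<Rightarrow> bool" where
  "bypassing P G \<longleftrightarrow>
     gverts G = cells P 0 \<and> (\<forall>e\<in>cells P 1. \<exists>p. walk_in P G p \<and> contracts_to P p [e])"

definition shortest_bypasses ::
    "('a, 'b) gorder_scheme \<Rightarrow> 'a skel_graph \<Rightarrow> 'a \<Rightarrow> 'a list set" where
  "shortest_bypasses P G e =
     {p. is_arg_min length (\<lambda>q. walk_in P G q \<and> contracts_to P q [e]) p}"

definition graph_metric :: "('a, 'b) gorder_scheme \<Rightarrow> 'a skel_graph \<Rightarrow> 'a \<Rightarrow> nat" where
  "graph_metric P G e = (THE n. length ` shortest_bypasses P G e = {n})"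

end

theory Submission
  imports Defs
begin

text \<open>By the triangle inequality an elementary contraction does not increase the total length of a
  walk with respect to any metric, so \<open>d'\<close> and \<open>d''\<close> of a walk \<open>p\<close> in \<open>B\<^sub>G(e)\<close> are at least
  \<open>d'(e)\<close> and \<open>d''(e)\<close>. Every edge of \<open>G\<close> has \<open>d\<^sub>G\<close>-length \<open>1\<close>, so the two total lengths of
  \<open>p\<close> add up to the number of edges of \<open>p\<close>, which is \<open>d\<^sub>G(e) = d'(e) + d''(e)\<close>. Hence both
  inequalities are equalities.\<close>

text \<open>The parts \<open>xs\<close> and \<open>ys\<close> contribute equally to both sums, so
  the claim reduces to the triangle inequality \<open>d c \<le> d a + d b\<close>.\<close>

lemma elementary_contraction_sum_le:
  assumes "metric_on_poset P d" and "elementary_contraction P p q"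
  shows "(\<Sum>x\<leftarrow>q. d x) \<le> (\<Sum>x\<leftarrow>p. d x)"
proof -
  obtain xs ys a b c t where tri: "triangle_with_facets P t a b c"
    and p: "p = xs @ [a, b] @ ys" and q: "q = xs @ [c] @ ys"
    using assms(2) unfolding elementary_contraction_def by blast
  have "d c \<le> d a + d b"
    using assms(1) tri unfolding metric_on_poset_def by blast
  then show ?thesis by (simp add: p q)
qed

lemma contracts_to_sum_le:
  assumes "metric_on_poset P d" and "contracts_to P p q"
  shows "(\<Sum>x\<leftarrow>q. d x) \<le> (\<Sum>x\<leftarrow>p. d x)"
  using assms(2) unfolding contracts_to_def
proof (induction rule: rtranclp_induct)
  case base
  show ?case by simp
next
  case (step q r)
  then show ?case using elementary_contraction_sum_le[OF assms(1) step.hyps(2)] by linarith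
qed

text \<open>Of two walks of minimal length neither is strictly shorter, so the image under
  \<open>length\<close> has at most one element; \<open>p\<close> makes it nonempty, and the
  \<open>THE\<close> is well defined.\<close>

lemma graph_metric_eq_length:
  assumes "p \<in> shortest_bypasses P G e"
  shows "graph_metric P G e = length p"
proof -
  have "length q = length p" if "q \<in> shortest_bypasses P G e" for q
    using assms that unfolding shortest_bypasses_def is_arg_min_def mem_Collect_eq
    by (meson linorder_neqE_nat)
  then have "length ` shortest_bypasses P G e = {length p}"
    using assms by blast
  then show ?thesis by (simp add: graph_metric_def)
qed

text \<open>Allows \<open>graph_metric\<close> to be evaluated on each edge of a shortest
  walk.\<close>

lemma walk_in_singleton:
  assumes "walk_in P G p" and "x \<in> set p"
  shows "walk_in P G [x]"
proof -
  obtain vs where vs: "length vs = length p + 1" "set vs \<subseteq> gverts G"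
    "\<And>i. i < length p \<Longrightarrow> endpoints P (p ! i) = {vs ! i, vs ! (i + 1)}"
    using assms(1) unfolding walk_in_def by blast
  obtain i where i: "i < length p" "x = p ! i"
    using assms(2) by (metis in_set_conv_nth)
  have "set [vs ! i, vs ! (i + 1)] \<subseteq> gverts G"
    using vs(1,2) i(1) by (auto intro: nth_mem)
  moreover have "x \<in> gedges G"
    using assms unfolding walk_in_def by blast
  ultimately show ?thesis
    unfolding walk_in_def using vs(3)[OF i(1)] i(2)
    by (intro conjI exI[of _ "[vs ! i, vs ! (i + 1)]"]) auto
qed

text \<open>\<open>[x]\<close> contracts to itself in zero steps, and walks are nonempty, so none is
  shorter.\<close>

lemma graph_metric_eq_1:
  assumes "walk_in P G [x]"
  shows "graph_metric P G x = 1"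
proof -
  have "contracts_to P [x] [x]"
    by (simp add: contracts_to_def)
  moreover have "\<not> length q < length [x]" if "walk_in P G q" for q
    using that unfolding walk_in_def by simp
  ultimately have "[x] \<in> shortest_bypasses P G x"
    using assms unfolding shortest_bypasses_def is_arg_min_def by blast
  then show ?thesis by (simp add: graph_metric_eq_length)
qed

theorem theorem4p7:
  fixes P :: "('a, 'b) gorder_scheme" and G :: "'a skel_graph"
    and d' d'' :: "'a \<Rightarrow> real" and e :: 'a and p :: "'a list"
  assumes "simplicial_poset P" and "pure_two_dimensional P"
    and "subgraph_of_skeleton P G" and "bypassing P G"
    and "metric_on_poset P d'" and "metric_on_poset P d''"
    and "\<forall>x\<in>cells P 1. real (graph_metric P G x) = d' x + d'' x"
    and "e \<in> cells P 1" and "shortest_bypasses P G e \<noteq> {}"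
    and "p \<in> shortest_bypasses P G e"
  shows "(\<Sum>x\<leftarrow>p. d' x) = d' e"
proof -
  have walk: "walk_in P G p" and contr: "contracts_to P p [e]"
    using assms(10) by (auto simp: shortest_bypasses_def is_arg_min_def)
  have le': "d' e \<le> (\<Sum>x\<leftarrow>p. d' x)" and le'': "d'' e \<le> (\<Sum>x\<leftarrow>p. d'' x)"
    using contracts_to_sum_le[OF assms(5) contr] contracts_to_sum_le[OF assms(6) contr]
    by simp_all
  have "d' x + d'' x = 1" if "x \<in> set p" for x
  proof -
    \<comment> \<open>The decomposition of \<open>graph_metric\<close> is assumed on
      \<open>cells P 1\<close>, which contains the edges of \<open>G\<close>.\<close>
    have "x \<in> cells P 1"
      using walk assms(3) that
      by (auto simp: walk_in_def subgraph_of_skeleton_def one_skeleton_def)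
    then show ?thesis
      using assms(7) graph_metric_eq_1[OF walk_in_singleton[OF walk that]] by force
  qed
  then have "(\<Sum>x\<leftarrow>p. d' x + d'' x) = (\<Sum>x\<leftarrow>p. 1)"
    by (simp cong: map_cong)
  also have "\<dots> = real (graph_metric P G e)"
    by (simp add: graph_metric_eq_length[OF assms(10)] sum_list_triv)
  also have "\<dots> = d' e + d'' e"
    using assms(7,8) by blast
  finally show ?thesis
    using le' le'' by (simp add: sum_list_addf)
qed

end
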